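(* Let $I$ be a semiprime ideal of a commutative ring $R$, and let $R/\!\!/I:=R[X]/XI[X]$. Then the extension $R\subseteq R/\!\!/I$ is SL, pure and t-closed. Moreover, $I=(R:R/\!\!/I)$, and $I$ is also a semiprime ideal of $R/\!\!/I$. If $R$ is reduced, then $R/\!\!/I$ is reduced.
   Context: All rings are commutative, unital and nonzero. $X$ is an indeterminate over $R$; for an ideal $I$ of $R$, $I[X]=IR[X]$ is the ideal of polynomials with coefficients in $I$, and $XI[X]$ is the ideal of $R[X]$ of products $Xg(X)$ with $g\in I[X]$. Since $XI[X]\cap R=0$, the composite $R\to R[X]\to R/\!\!/I$ is injective and $R$ is viewed as a subring of $R/\!\!/I$. An ideal is semiprime if it is an intersection of prime ideals (i.e. a radical ideal). $\mathrm U(A)$ is the group of units of a ring $A$. For an extension $R\subseteq S$: $(R:S)=\{r\in R\mid rS\subseteq R\}$ is its conductor; the extension is SL (strongly local) if $\mathrm U(R)=\mathrm U(S)$; it is pure if $R'\to R'\otimes_RS$ is injective for each ring morphism $R\to R'$; it is t-closed if every $b\in S$ such that $b^2-rb\in R$ and $b^3-rb^2\in R$ for some $r\in R$ belongs to $R$. *)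

theory Defs
  imports "HOL-Algebra.Algebra"
begin

section \<open>Semiprime ideals and reduced rings\<close>

text \<open>The intersection is taken inside the carrier, so that the empty family yields the unit
  ideal, which is a radical ideal.\<close>

definition semiprime_ideal :: "'a set \<Rightarrow> ('a, 'm) ring_scheme \<Rightarrow> bool" where
  "semiprime_ideal I R \<longleftrightarrow>
     (\<exists>\<P>. (\<forall>P\<in>\<P>. primeideal P R) \<and> I = carrier R \<inter> \<Inter>\<P>)"

definition reduced_ring :: "('a, 'm) ring_scheme \<Rightarrow> bool" where
  "reduced_ring R \<longleftrightarrow>
     (\<forall>a\<in>carrier R. \<forall>n::nat. a [^]\<^bsub>R\<^esub> n = \<zero>\<^bsub>R\<^esub> \<longrightarrow> a = \<zero>\<^bsub>R\<^esub>)"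

section \<open>Tensor products\<close>

text \<open>For homomorphisms \<open>f : R \<rightarrow> A\<close> and \<open>g : R \<rightarrow> B\<close> of commutative rings, the tensor product of
  \<open>A\<close> and \<open>B\<close> over \<open>R\<close> is built as an additive group: the free abelian group on the pairs
  \<open>(a, b)\<close> modulo the subgroup of bilinearity and \<open>R\<close>-balancing relations. Its ring structure is
  not needed to speak of the injectivity of \<open>a \<mapsto> a \<otimes> 1\<close>. Note that \<open>+\<close> and \<open>-\<close> below are those of
  the free abelian group.\<close>

definition tensor_relations ::
  "('r, 'k) ring_scheme \<Rightarrow> ('r \<Rightarrow> 'a) \<Rightarrow> ('a, 'm) ring_scheme \<Rightarrow> ('r \<Rightarrow> 'b) \<Rightarrow> ('b, 'n) ring_scheme
     \<Rightarrow> ('a \<times> 'b \<Rightarrow>\<^sub>0 int) set" where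
  "tensor_relations R f A g B =
     {frag_of (a \<oplus>\<^bsub>A\<^esub> a', b) - (frag_of (a, b) + frag_of (a', b)) | a a' b.
        a \<in> carrier A \<and> a' \<in> carrier A \<and> b \<in> carrier B} \<union>
     {frag_of (a, b \<oplus>\<^bsub>B\<^esub> b') - (frag_of (a, b) + frag_of (a, b')) | a b b'.
        a \<in> carrier A \<and> b \<in> carrier B \<and> b' \<in> carrier B} \<union>
     {frag_of (a \<otimes>\<^bsub>A\<^esub> f r, b) - frag_of (a, g r \<otimes>\<^bsub>B\<^esub> b) | a r b.
        a \<in> carrier A \<and> r \<in> carrier R \<and> b \<in> carrier B}"

definition tensor_kernel ::
  "('r, 'k) ring_scheme \<Rightarrow> ('r \<Rightarrow> 'a) \<Rightarrow> ('a, 'm) ring_scheme \<Rightarrow> ('r \<Rightarrow> 'b) \<Rightarrow> ('b, 'n) ring_scheme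
     \<Rightarrow> ('a \<times> 'b \<Rightarrow>\<^sub>0 int) set" where
  "tensor_kernel R f A g B =
     generate (free_Abelian_group (carrier A \<times> carrier B)) (tensor_relations R f A g B)"

definition tensor_product ::
  "('r, 'k) ring_scheme \<Rightarrow> ('r \<Rightarrow> 'a) \<Rightarrow> ('a, 'm) ring_scheme \<Rightarrow> ('r \<Rightarrow> 'b) \<Rightarrow> ('b, 'n) ring_scheme
     \<Rightarrow> ('a \<times> 'b \<Rightarrow>\<^sub>0 int) set monoid" where
  "tensor_product R f A g B =
     free_Abelian_group (carrier A \<times> carrier B) Mod tensor_kernel R f A g B"

definition pure_tensor ::
  "('r, 'k) ring_scheme \<Rightarrow> ('r \<Rightarrow> 'a) \<Rightarrow> ('a, 'm) ring_scheme \<Rightarrow> ('r \<Rightarrow> 'b) \<Rightarrow> ('b, 'n) ring_scheme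
     \<Rightarrow> 'a \<Rightarrow> 'b \<Rightarrow> ('a \<times> 'b \<Rightarrow>\<^sub>0 int) set" where
  "pure_tensor R f A g B a b =
     tensor_kernel R f A g B
       #>\<^bsub>free_Abelian_group (carrier A \<times> carrier B)\<^esub> frag_of (a, b)"

section \<open>Extensions of commutative rings\<close>

text \<open>An extension is a ring \<open>S\<close> together with a subring, given by its carrier \<open>K\<close>; the subring
  itself is \<open>S\<lparr>carrier := K\<rparr>\<close>.\<close>

definition conductor :: "'s set \<Rightarrow> ('s, 'n) ring_scheme \<Rightarrow> 's set" where
  "conductor K S = {r \<in> K. \<forall>s\<in>carrier S. r \<otimes>\<^bsub>S\<^esub> s \<in> K}"

definition strongly_local :: "'s set \<Rightarrow> ('s, 'n) ring_scheme \<Rightarrow> bool" where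
  "strongly_local K S \<longleftrightarrow> Units (S\<lparr>carrier := K\<rparr>) = Units S"

definition t_closed :: "'s set \<Rightarrow> ('s, 'n) ring_scheme \<Rightarrow> bool" where
  "t_closed K S \<longleftrightarrow>
     (\<forall>b\<in>carrier S.
        (\<exists>r\<in>K. b [^]\<^bsub>S\<^esub> (2::nat) \<ominus>\<^bsub>S\<^esub> r \<otimes>\<^bsub>S\<^esub> b \<in> K \<and>
                b [^]\<^bsub>S\<^esub> (3::nat) \<ominus>\<^bsub>S\<^esub> r \<otimes>\<^bsub>S\<^esub> b [^]\<^bsub>S\<^esub> (2::nat) \<in> K)
        \<longrightarrow> b \<in> K)"

text \<open>A definition cannot quantify over types, so the element type \<open>'c\<close> of the base change ring is
  a parameter. An extension is pure if this predicate holds for every type \<open>'c\<close>; a theorem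
  concluding \<open>pure_extension TYPE('c) K S\<close> for a type variable \<open>'c\<close> that occurs nowhere else
  says exactly that.\<close>

definition pure_extension :: "'c itself \<Rightarrow> 's set \<Rightarrow> ('s, 'n) ring_scheme \<Rightarrow> bool" where
  "pure_extension (_ :: 'c itself) K S \<longleftrightarrow>
     (\<forall>(R' :: 'c ring) h.
        cring R' \<and> \<one>\<^bsub>R'\<^esub> \<noteq> \<zero>\<^bsub>R'\<^esub> \<and> h \<in> ring_hom (S\<lparr>carrier := K\<rparr>) R' \<longrightarrow>
        inj_on (\<lambda>x. pure_tensor (S\<lparr>carrier := K\<rparr>) h R' id S x \<one>\<^bsub>S\<^esub>) (carrier R'))"

section \<open>The ring \<open>R//I\<close>\<close>

definition coeff_ideal :: "('a, 'm) ring_scheme \<Rightarrow> 'a set \<Rightarrow> (nat \<Rightarrow> 'a) set" where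
  "coeff_ideal R I = {g \<in> carrier (UP R). \<forall>n. coeff (UP R) g n \<in> I}"

definition X_coeff_ideal :: "('a, 'm) ring_scheme \<Rightarrow> 'a set \<Rightarrow> (nat \<Rightarrow> 'a) set" where
  "X_coeff_ideal R I = {monom (UP R) \<one>\<^bsub>R\<^esub> 1 \<otimes>\<^bsub>UP R\<^esub> g | g. g \<in> coeff_ideal R I}"

definition slash_ring :: "('a, 'm) ring_scheme \<Rightarrow> 'a set \<Rightarrow> (nat \<Rightarrow> 'a) set ring" where
  "slash_ring R I = UP R Quot X_coeff_ideal R I"

definition slash_emb :: "('a, 'm) ring_scheme \<Rightarrow> 'a set \<Rightarrow> 'a \<Rightarrow> (nat \<Rightarrow> 'a) set" where
  "slash_emb R I r = X_coeff_ideal R I +>\<^bsub>UP R\<^esub> monom (UP R) r 0"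

text \<open>The facts below justify viewing \<open>R\<close> as the subring \<open>slash_emb R I ` carrier R\<close> of
  \<open>slash_ring R I\<close>.\<close>

lemma semiprime_ideal_imp_ideal:
  assumes "cring R" "semiprime_ideal I R"
  shows "ideal I R"
proof -
  interpret cring R by fact
  from assms(2) obtain P where P: "\<And>J. J \<in> P \<Longrightarrow> primeideal J R" "I = carrier R \<inter> \<Inter>P"
    unfolding semiprime_ideal_def by blast
  have "I = \<Inter>(insert (carrier R) P)" using P(2) by auto
  moreover have "ideal (\<Inter>(insert (carrier R) P)) R"
    using P(1) by (intro i_Intersect) (auto simp: oneideal primeideal.axioms(1))
  ultimately show ?thesis by simp
qed

context
  fixes R :: "('a, 'm) ring_scheme" (structure) and I
  assumes R: "cring R" and I: "ideal I R"
begin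

interpretation R: UP_cring R "UP R"
  by (rule UP_cring.intro) (auto simp: R)

interpretation I: ideal I R by (rule I)

lemma ideal_X_coeff_ideal: "ideal (X_coeff_ideal R I) (UP R)"
proof -
  let ?P = "UP R" and ?X = "monom (UP R) \<one> 1" and ?J = "X_coeff_ideal R I"
  have X: "?X \<in> carrier ?P" by simp
  have mult: "x \<otimes>\<^bsub>?P\<^esub> a \<in> ?J" if a: "a \<in> ?J" and x: "x \<in> carrier ?P" for a x
  proof -
    from a obtain g where g: "a = ?X \<otimes>\<^bsub>?P\<^esub> g" "g \<in> carrier ?P" "\<And>n. coeff ?P g n \<in> I"
      by (auto simp: X_coeff_ideal_def coeff_ideal_def)
    have "coeff ?P (x \<otimes>\<^bsub>?P\<^esub> g) n \<in> I" for n
    proof -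
      have *: "finite A \<Longrightarrow> f \<in> A \<rightarrow> I \<Longrightarrow> finsum R f A \<in> I" for f and A :: "nat set"
        by (induction rule: finite_induct) (auto simp: Pi_iff)
      show ?thesis using g x by (auto intro!: * I.I_l_closed)
    qed
    moreover have "x \<otimes>\<^bsub>?P\<^esub> a = ?X \<otimes>\<^bsub>?P\<^esub> (x \<otimes>\<^bsub>?P\<^esub> g)"
      using g(1,2) x X by (simp add: R.P.m_lcomm)
    ultimately show ?thesis
      using g x by (auto simp: X_coeff_ideal_def coeff_ideal_def)
  qed
  have sub: "?J \<subseteq> carrier ?P"
    using X by (auto simp: X_coeff_ideal_def coeff_ideal_def)
  show ?thesis
  proof (rule idealI)
    show "subgroup ?J (add_monoid ?P)"
    proof (rule R.P.add.subgroupI)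
      show "?J \<subseteq> carrier ?P" by (rule sub)
      have "\<zero>\<^bsub>?P\<^esub> \<in> coeff_ideal R I" by (simp add: coeff_ideal_def)
      then show "?J \<noteq> {}" by (auto simp: X_coeff_ideal_def)
    next
      fix a assume a: "a \<in> ?J"
      then have "(\<ominus>\<^bsub>?P\<^esub> \<one>\<^bsub>?P\<^esub>) \<otimes>\<^bsub>?P\<^esub> a \<in> ?J" by (intro mult) auto
      then show "\<ominus>\<^bsub>?P\<^esub> a \<in> ?J" using a sub by (auto simp: R.P.l_minus subset_iff)
    next
      fix a b assume "a \<in> ?J" "b \<in> ?J"
      then obtain g h where
        g: "a = ?X \<otimes>\<^bsub>?P\<^esub> g" "g \<in> carrier ?P" "\<And>n. coeff ?P g n \<in> I" and
        h: "b = ?X \<otimes>\<^bsub>?P\<^esub> h" "h \<in> carrier ?P" "\<And>n. coeff ?P h n \<in> I"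
        by (auto simp: X_coeff_ideal_def coeff_ideal_def)
      have "a \<oplus>\<^bsub>?P\<^esub> b = ?X \<otimes>\<^bsub>?P\<^esub> (g \<oplus>\<^bsub>?P\<^esub> h)"
        using g h X by (simp add: R.P.r_distr)
      moreover have "g \<oplus>\<^bsub>?P\<^esub> h \<in> coeff_ideal R I"
        using g h by (auto simp: coeff_ideal_def)
      ultimately show "a \<oplus>\<^bsub>?P\<^esub> b \<in> ?J" by (auto simp: X_coeff_ideal_def)
    qed
  next
    fix a x assume "a \<in> ?J" "x \<in> carrier ?P"
    then show "x \<otimes>\<^bsub>?P\<^esub> a \<in> ?J" "a \<otimes>\<^bsub>?P\<^esub> x \<in> ?J"
      using mult[of a x] sub by (auto simp: R.P.m_comm subset_iff)
  qed (rule R.P.ring_axioms)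
qed

lemma cring_slash_ring: "cring (slash_ring R I)"
  unfolding slash_ring_def
  by (rule ideal.quotient_is_cring[OF ideal_X_coeff_ideal R.P.is_cring])

lemma slash_emb_ring_hom: "slash_emb R I \<in> ring_hom R (slash_ring R I)"
proof -
  have 1: "(\<lambda>r. monom (UP R) r 0) \<in> ring_hom R (UP R)"
  proof (rule ring_hom_memI)
    fix x y assume "x \<in> carrier R" "y \<in> carrier R"
    then show "monom (UP R) (x \<otimes> y) 0 = monom (UP R) x 0 \<otimes>\<^bsub>UP R\<^esub> monom (UP R) y 0"
      using R.monom_mult[of x y 0 0] by simp
  qed auto
  have "(\<lambda>p. X_coeff_ideal R I +>\<^bsub>UP R\<^esub> p) \<circ> (\<lambda>r. monom (UP R) r 0)
          \<in> ring_hom R (slash_ring R I)"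
    unfolding slash_ring_def
    by (rule ring_hom_trans[OF 1 ideal.rcos_ring_hom[OF ideal_X_coeff_ideal]])
  then show ?thesis by (simp add: slash_emb_def[abs_def] comp_def)
qed

lemma inj_on_slash_emb: "inj_on (slash_emb R I) (carrier R)"
proof
  interpret J: ideal "X_coeff_ideal R I" "UP R" by (rule ideal_X_coeff_ideal)
  fix r s assume rs: "r \<in> carrier R" "s \<in> carrier R" "slash_emb R I r = slash_emb R I s"
  let ?P = "UP R"
  have "monom ?P r 0 \<in> X_coeff_ideal R I +>\<^bsub>?P\<^esub> monom ?P r 0"
    by (rule J.a_rcos_self) (simp add: rs)
  then have "monom ?P r 0 \<in> X_coeff_ideal R I +>\<^bsub>?P\<^esub> monom ?P s 0"
    using rs(3) by (simp add: slash_emb_def)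
  then obtain g where g: "g \<in> carrier ?P"
    and eq: "monom ?P r 0 = (monom ?P \<one> 1 \<otimes>\<^bsub>?P\<^esub> g) \<oplus>\<^bsub>?P\<^esub> monom ?P s 0"
    unfolding a_r_coset_def' X_coeff_ideal_def coeff_ideal_def by blast
  have "r = coeff ?P (monom ?P r 0) 0" using rs by simp
  also have "\<dots> = coeff ?P (monom ?P \<one> 1 \<otimes>\<^bsub>?P\<^esub> g) 0 \<oplus> s"
    using rs g by (subst eq) simp
  also have "\<dots> = s" using rs g by simp
  finally show "r = s" .
qed

lemma subcring_slash_emb: "subcring (slash_emb R I ` carrier R) (slash_ring R I)"
proof -
  interpret S: cring "slash_ring R I" by (rule cring_slash_ring)
  interpret h: ring_hom_ring R "slash_ring R I" "slash_emb R I"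
    by (rule ring_hom_ringI2[OF R.R.ring_axioms S.ring_axioms slash_emb_ring_hom])
  show ?thesis
    by (rule S.subcringI'[OF h.img_is_subring[OF R.R.carrier_is_subring]])
qed

end

end

theory Submission
  imports Defs
begin

text \<open>Modulo \<open>X I[X]\<close>, a polynomial is constant iff all its coefficients of positive degree lie in
  \<open>I\<close>, that is, in each of the primes \<open>Q\<close> whose intersection is \<open>I\<close>. For such a \<open>Q\<close> the degree modulo
  \<open>Q\<close> is additive on products. Hence a unit is constant modulo every \<open>Q\<close>, and so is every \<open>f\<close> such that
  \<open>f (f - c)\<close> is constant modulo \<open>I\<close>; this gives SL and t-closedness. Purity holds because evaluation
  at \<open>X = 0\<close> retracts \<open>R//I\<close> onto \<open>R\<close>. Finally \<open>(R//I)/I = (R/I)[X]\<close>, so the primes \<open>Q[X]/X I[X]\<close>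
  intersect in \<open>I\<close>.\<close>

section \<open>Retracts are pure\<close>

text \<open>Base change of the retraction gives an additive map on the tensor product that sends
  \<open>a \<otimes> s\<close> to \<open>a h(\<rho>(s))\<close>, hence \<open>a \<otimes> 1\<close>
  back to \<open>a\<close>. So \<open>a \<otimes> 1\<close> determines \<open>a\<close>.\<close>

lemma retract_imp_pure_extension:
  fixes S :: "('s, 'n) ring_scheme"
  assumes S: "cring S" and K: "subcring K S"
    and \<rho>: "\<rho> \<in> ring_hom S (S\<lparr>carrier := K\<rparr>)" and id_on: "\<And>x. x \<in> K \<Longrightarrow> \<rho> x = x"
  shows "pure_extension TYPE('c) K S"
  unfolding pure_extension_def
proof (intro allI impI inj_onI, elim conjE)
  fix A :: "'c ring" and h x y
  let ?K = "S\<lparr>carrier := K\<rparr>"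
  let ?F = "free_Abelian_group (carrier A \<times> carrier S)"
  let ?N = "tensor_kernel ?K h A id S"
  assume A: "cring A" and h: "h \<in> ring_hom ?K A"
    and xy: "x \<in> carrier A" "y \<in> carrier A"
    and eq: "pure_tensor ?K h A id S x \<one>\<^bsub>S\<^esub> = pure_tensor ?K h A id S y \<one>\<^bsub>S\<^esub>"
  interpret A: cring A by fact
  interpret S: cring S by fact
  interpret K: subcring K S by fact
  interpret F: group ?F by simp
  have \<rho>_closed: "\<rho> s \<in> K" if "s \<in> carrier S" for s
    using ring_hom_closed[OF \<rho> that] by simp
  have h_closed: "h s \<in> carrier A" if "s \<in> K" for s
    using ring_hom_closed[OF h] that by simp
  have h_add: "h (s \<oplus>\<^bsub>S\<^esub> t) = h s \<oplus>\<^bsub>A\<^esub> h t" and h_mult: "h (s \<otimes>\<^bsub>S\<^esub> t) = h s \<otimes>\<^bsub>A\<^esub> h t"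
    if "s \<in> K" "t \<in> K" for s t
    using ring_hom_add[OF h, of s t] ring_hom_mult[OF h, of s t] that by simp_all
  have \<rho>_add: "\<rho> (s \<oplus>\<^bsub>S\<^esub> t) = \<rho> s \<oplus>\<^bsub>S\<^esub> \<rho> t" and \<rho>_mult: "\<rho> (s \<otimes>\<^bsub>S\<^esub> t) = \<rho> s \<otimes>\<^bsub>S\<^esub> \<rho> t"
    if "s \<in> carrier S" "t \<in> carrier S" for s t
    using ring_hom_add[OF \<rho>, of s t] ring_hom_mult[OF \<rho>, of s t] that by simp_all
  have K_sub: "s \<in> carrier S" if "s \<in> K" for s using K.subset that by auto
  \<comment> \<open>\<open>?f\<close> prescribes this map on the generators of the free abelian
    group. Instead of descending to the quotient, it suffices that the extension
    \<open>\<phi>\<close> kills all relations.\<close>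
  let ?f = "\<lambda>(a, s). a \<otimes>\<^bsub>A\<^esub> h (\<rho> s)"
  have "?f ` (carrier A \<times> carrier S) \<subseteq> carrier (add_monoid A)"
    using h_closed \<rho>_closed by auto
  from comm_group.free_Abelian_group_universal[OF A.a_comm_group this] obtain \<phi>
    where \<phi>: "\<phi> \<in> hom ?F (add_monoid A)"
      and \<phi>_of: "\<And>p. p \<in> carrier A \<times> carrier S \<Longrightarrow> \<phi> (frag_of p) = ?f p"
    by metis
  interpret \<phi>: group_hom ?F "add_monoid A" \<phi>
    by (rule group_hom.intro) (use A.a_group \<phi> in \<open>simp_all add: group_hom_axioms_def\<close>)
  have \<phi>_frag: "\<phi> (frag_of (a, s)) = a \<otimes>\<^bsub>A\<^esub> h (\<rho> s)" if "a \<in> carrier A" "s \<in> carrier S" for a s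
    using \<phi>_of[of "(a, s)"] that by simp
  have \<phi>_add: "\<phi> (u + v) = \<phi> u \<oplus>\<^bsub>A\<^esub> \<phi> v" if "u \<in> carrier ?F" "v \<in> carrier ?F" for u v
    using hom_mult[OF \<phi> that] by simp
  have add_closed: "u + v \<in> carrier ?F" if "u \<in> carrier ?F" "v \<in> carrier ?F" for u v
    using F.m_closed[OF that] by simp
  have diff_closed: "u - v \<in> carrier ?F" if "u \<in> carrier ?F" "v \<in> carrier ?F" for u v
    using that keys_diff[of u v] by auto
  have \<phi>_diff: "\<phi> (u - v) = \<zero>\<^bsub>A\<^esub>" if "u \<in> carrier ?F" "v \<in> carrier ?F" "\<phi> u = \<phi> v" for u v
  proof -
    have "\<phi> (u - v) \<oplus>\<^bsub>A\<^esub> \<phi> v = \<phi> v"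
      using \<phi>_add[OF diff_closed[OF that(1,2)] that(2)] that(3) by simp
    moreover have "\<phi> (u - v) \<in> carrier A" "\<phi> v \<in> carrier A"
      using hom_in_carrier[OF \<phi>] diff_closed that by auto
    ultimately show ?thesis by (simp add: A.add.r_cancel_one)
  qed
  have fr: "frag_of (a, s) \<in> carrier ?F" if "a \<in> carrier A" "s \<in> carrier S" for a s
    using that by simp
  \<comment> \<open>Each relation is a difference, so \<open>\<phi>_diff\<close> reduces its
    vanishing to an equality of two values. For the two additivity relations this is distributivity
    in \<open>A\<close>, with additivity of \<open>h\<close> and \<open>\<rho>\<close> for the
    second.\<close>
  have rel: "tensor_relations ?K h A id S \<subseteq> kernel ?F (add_monoid A) \<phi>"
  proof
    fix u assume "u \<in> tensor_relations ?K h A id S"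
    then consider
        (left) a a' s where "u = frag_of (a \<oplus>\<^bsub>A\<^esub> a', s) - (frag_of (a, s) + frag_of (a', s))"
          "a \<in> carrier A" "a' \<in> carrier A" "s \<in> carrier S"
      | (right) a s s' where "u = frag_of (a, s \<oplus>\<^bsub>S\<^esub> s') - (frag_of (a, s) + frag_of (a, s'))"
          "a \<in> carrier A" "s \<in> carrier S" "s' \<in> carrier S"
      | (balanced) a r s where "u = frag_of (a \<otimes>\<^bsub>A\<^esub> h r, s) - frag_of (a, r \<otimes>\<^bsub>S\<^esub> s)"
          "a \<in> carrier A" "r \<in> K" "s \<in> carrier S"
      unfolding tensor_relations_def by auto
    then show "u \<in> kernel ?F (add_monoid A) \<phi>"
    proof cases
      case left
      then have "\<phi> u = \<zero>\<^bsub>A\<^esub>" unfolding left(1)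
        by (intro \<phi>_diff add_closed fr)
           (auto simp: \<phi>_frag \<phi>_add h_closed \<rho>_closed A.l_distr simp del: carrier_free_Abelian_group_iff)
      moreover have "u \<in> carrier ?F" unfolding left(1)
        using left by (intro diff_closed add_closed fr) auto
      ultimately show ?thesis by (simp add: kernel_def)
    next
      case right
      then have "\<phi> u = \<zero>\<^bsub>A\<^esub>" unfolding right(1)
        by (intro \<phi>_diff add_closed fr)
           (auto simp: \<phi>_frag \<phi>_add h_closed \<rho>_closed A.r_distr \<rho>_add h_add
             simp del: carrier_free_Abelian_group_iff)
      moreover have "u \<in> carrier ?F" unfolding right(1)
        using right by (intro diff_closed add_closed fr) auto
      ultimately show ?thesis by (simp add: kernel_def)
    next
      \<comment> \<open>Here \<open>\<rho>\<close> being the identity on \<open>K\<close> enters: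
        \<open>\<rho> (r s) = r \<rho> s\<close>, so \<open>h r\<close> can be moved between the
        factors.\<close>
      case balanced
      then have "\<phi> u = \<zero>\<^bsub>A\<^esub>" unfolding balanced(1)
        by (intro \<phi>_diff fr)
           (auto simp: \<phi>_frag h_closed \<rho>_closed A.m_assoc \<rho>_mult h_mult id_on K_sub
             simp del: carrier_free_Abelian_group_iff)
      moreover have "u \<in> carrier ?F" unfolding balanced(1)
        using balanced by (intro diff_closed fr) (auto simp: h_closed K_sub)
      ultimately show ?thesis by (simp add: kernel_def)
    qed
  qed
  have N_sub: "?N \<subseteq> kernel ?F (add_monoid A) \<phi>"
    unfolding tensor_kernel_def
    by (rule F.generate_subgroup_incl[OF rel \<phi>.subgroup_kernel])
  have "subgroup ?N ?F"
    unfolding tensor_kernel_def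
    by (rule F.generate_is_subgroup) (use rel in \<open>auto simp: kernel_def\<close>)
  \<comment> \<open>The generator for \<open>x\<close> lies in its own coset, hence in that of
    \<open>y\<close>; the two generators differ by an element of \<open>?N\<close>, on which
    \<open>\<phi>\<close> vanishes.\<close>
  then have "frag_of (x, \<one>\<^bsub>S\<^esub>) \<in> ?N #>\<^bsub>?F\<^esub> frag_of (x, \<one>\<^bsub>S\<^esub>)"
    by (intro F.rcos_self fr xy) auto
  then have "frag_of (x, \<one>\<^bsub>S\<^esub>) \<in> ?N #>\<^bsub>?F\<^esub> frag_of (y, \<one>\<^bsub>S\<^esub>)"
    using eq by (simp add: pure_tensor_def)
  then obtain n where n: "n \<in> ?N" "frag_of (x, \<one>\<^bsub>S\<^esub>) = n + frag_of (y, \<one>\<^bsub>S\<^esub>)"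
    by (auto simp: r_coset_def)
  then have "\<phi> n = \<zero>\<^bsub>A\<^esub>" "n \<in> carrier ?F"
    using N_sub by (auto simp: kernel_def)
  then have *: "\<phi> (frag_of (x, \<one>\<^bsub>S\<^esub>)) = \<zero>\<^bsub>A\<^esub> \<oplus>\<^bsub>A\<^esub> \<phi> (frag_of (y, \<one>\<^bsub>S\<^esub>))"
    unfolding n(2) using \<phi>_add[of n] fr xy by simp
  have "h (\<rho> \<one>\<^bsub>S\<^esub>) = \<one>\<^bsub>A\<^esub>"
    using ring_hom_one[OF h] ring_hom_one[OF \<rho>] by simp
  then show "x = y" using * xy by (simp add: \<phi>_frag)
qed

section \<open>Polynomials modulo a prime ideal\<close>

context UP_cring
begin

text \<open>Within \<open>UP_cring\<close> the unqualified names \<open>coeff\<close> and \<open>monom\<close> denote the list-based polynomials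
  of \<open>HOL-Algebra\<close>.\<close>

abbreviation cf where "cf \<equiv> up_ring.coeff P"
abbreviation mon where "mon \<equiv> up_ring.monom P"

text \<open>\<open>i\<close> and \<open>j\<close> are the degrees of \<open>f\<close> and
  \<open>g\<close> modulo \<open>Q\<close>. In the convolution sum at \<open>i + j\<close>, every
  term but the product of the two leading coefficients has a factor in \<open>Q\<close>, and that
  product avoids \<open>Q\<close> by primality.\<close>

lemma prime_coeff_mult:
  assumes Q: "primeideal Q R" and fg: "f \<in> carrier P" "g \<in> carrier P"
    and i: "cf f i \<notin> Q" "\<And>k. k > i \<Longrightarrow> cf f k \<in> Q"
    and j: "cf g j \<notin> Q" "\<And>k. k > j \<Longrightarrow> cf g k \<in> Q"
  shows "cf (f \<otimes>\<^bsub>P\<^esub> g) (i + j) \<notin> Q"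
proof
  interpret Q: primeideal Q R by fact
  let ?t = "\<lambda>k. cf f k \<otimes> cf g (i + j - k)"
  let ?s = "finsum R ?t ({..i + j} - {i})"
  have sum: "finite A \<Longrightarrow> t \<in> A \<rightarrow> Q \<Longrightarrow> finsum R t A \<in> Q" for t and A :: "nat set"
    by (induction rule: finite_induct) (auto simp: Pi_iff)
  have "?t k \<in> Q" if "k \<in> {..i + j} - {i}" for k
  proof (cases "k > i")
    case True
    then show ?thesis using i(2) fg by (intro Q.I_r_closed) auto
  next
    case False
    \<comment> \<open>Since \<open>k\<close> is neither equal to \<open>i\<close> nor above it,
      \<open>k < i\<close>.\<close>
    then have "i + j - k > j" using that by auto
    then show ?thesis using j(2) fg by (intro Q.I_l_closed) auto
  qed
  then have s: "?s \<in> Q" by (intro sum) auto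
  have "finsum R ?t (insert i ({..i + j} - {i})) = ?t i \<oplus> ?s"
    using fg by (intro R.finsum_insert) auto
  moreover have "insert i ({..i + j} - {i}) = {..i + j}" by auto
  ultimately have c: "cf (f \<otimes>\<^bsub>P\<^esub> g) (i + j) = ?t i \<oplus> ?s" using fg by simp
  assume "cf (f \<otimes>\<^bsub>P\<^esub> g) (i + j) \<in> Q"
  then have "(?t i \<oplus> ?s) \<ominus> ?s \<in> Q" using s c Q.a_closed Q.a_inv_closed by (simp add: a_minus_def)
  moreover have "(?t i \<oplus> ?s) \<ominus> ?s = ?t i"
    using fg Q.a_Hcarr[OF s] by (simp add: a_minus_def R.a_assoc R.r_neg del: R.finsum_closed)
  ultimately have "?t i \<in> Q" by simp
  then show False using Q.I_prime[of "cf f i" "cf g j"] i j fg by simp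
qed

text \<open>The indices of coefficients outside \<open>Q\<close> are bounded by the degree, because
  zero lies in \<open>Q\<close>; their maximum is the degree modulo \<open>Q\<close>. The bound
  \<open>n \<le> i\<close> is kept because later arguments need positive degrees.\<close>

lemma prime_degree_exists:
  assumes Q: "ideal Q R" and f: "f \<in> carrier P" and n: "cf f n \<notin> Q"
  obtains i where "n \<le> i" "cf f i \<notin> Q" "\<And>k. k > i \<Longrightarrow> cf f k \<in> Q"
proof -
  interpret Q: ideal Q R by fact
  let ?D = "{k. cf f k \<notin> Q}"
  have "?D \<subseteq> {..deg R f}"
    using deg_aboveD[OF _ f] Q.zero_closed by (force simp: not_le[symmetric])
  then have fin: "finite ?D" by (rule finite_subset) simp
  show ?thesis
  proof (rule that)
    show "n \<le> Max ?D" using fin n by simp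
    show "cf f (Max ?D) \<notin> Q" using Max_in[OF fin] n by auto
    show "cf f k \<in> Q" if "k > Max ?D" for k
      using Max_ge[OF fin, of k] that by auto
  qed
qed

text \<open>The witness is the sum of the degrees modulo \<open>Q\<close>. The lower bound on
  \<open>k\<close> is the point: a factor that is not constant modulo \<open>Q\<close> makes the
  product not constant modulo \<open>Q\<close>.\<close>

lemma prime_coeffs_mult:
  assumes Q: "primeideal Q R" and fg: "f \<in> carrier P" "g \<in> carrier P"
    and m: "cf f m \<notin> Q" and n: "cf g n \<notin> Q"
  obtains k where "m + n \<le> k" "cf (f \<otimes>\<^bsub>P\<^esub> g) k \<notin> Q"
proof -
  note Q' = primeideal.axioms(1)[OF Q]
  obtain i where i: "m \<le> i" "cf f i \<notin> Q" "\<And>k. k > i \<Longrightarrow> cf f k \<in> Q"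
    using prime_degree_exists[OF Q' fg(1) m] by blast
  obtain j where j: "n \<le> j" "cf g j \<notin> Q" "\<And>k. k > j \<Longrightarrow> cf g k \<in> Q"
    using prime_degree_exists[OF Q' fg(2) n] by blast
  show ?thesis
    using prime_coeff_mult[OF Q fg i(2,3) j(2,3)] i(1) j(1) by (intro that[of "i + j"]) auto
qed

text \<open>\<open>(R/Q)[X]\<close> is a domain, so a nonzero polynomial over \<open>R/Q\<close> has
  no vanishing power. For exponent 0 the witness is the constant term \<open>\<one>\<close>, which
  is outside the proper ideal \<open>Q\<close>.\<close>

lemma prime_coeffs_pow:
  assumes Q: "primeideal Q R" and f: "f \<in> carrier P" and m: "cf f m \<notin> Q"
  shows "\<exists>k. cf (f [^]\<^bsub>P\<^esub> (n::nat)) k \<notin> Q"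
proof (induction n)
  case 0
  interpret Q: primeideal Q R by fact
  have "\<one> \<notin> Q" using Q.one_imp_carrier Q.I_notcarr by auto
  then show ?case by (intro exI[of _ 0]) simp
next
  case (Suc n)
  then obtain k where "cf (f [^]\<^bsub>P\<^esub> n) k \<notin> Q" by blast
  then obtain l where "cf (f [^]\<^bsub>P\<^esub> n \<otimes>\<^bsub>P\<^esub> f) l \<notin> Q"
    using prime_coeffs_mult[OF Q P.nat_pow_closed[OF f] f _ m] by metis
  then show ?case by (metis P.nat_pow_Suc)
qed

end

section \<open>Elements of \<open>R//I\<close>\<close>

locale slash_extension = UP_cring R P + I: ideal I R
  for R (structure) and P (structure) and I
begin

abbreviation S where "S \<equiv> slash_ring R I"
abbreviation emb where "emb \<equiv> slash_emb R I"
abbreviation K where "K \<equiv> emb ` carrier R"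

section \<open>Residue classes of polynomials and their coefficients\<close>

definition cls :: "(nat \<Rightarrow> 'a) \<Rightarrow> (nat \<Rightarrow> 'a) set" where
  "cls f = X_coeff_ideal R I +>\<^bsub>P\<^esub> f"

sublocale S: cring S
  by (rule cring_slash_ring[OF R.is_cring I.is_ideal])

text \<open>Multiplication by \<open>X\<close> shifts coefficients up by one, and a polynomial
  without constant term can be shifted back down.\<close>

lemma mem_X_coeff_ideal_iff:
  assumes f: "f \<in> carrier P"
  shows "f \<in> X_coeff_ideal R I \<longleftrightarrow> cf f 0 = \<zero> \<and> (\<forall>n. cf f n \<in> I)"
proof
  assume "f \<in> X_coeff_ideal R I"
  then obtain g where g: "f = mon \<one> 1 \<otimes>\<^bsub>P\<^esub> g" "g \<in> carrier P" "\<And>n. cf g n \<in> I"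
    by (auto simp: X_coeff_ideal_def coeff_ideal_def P_def)
  have "cf f 0 = \<zero>" using g by simp
  moreover have "cf f n \<in> I" for n
  proof (cases n)
    case 0
    then show ?thesis using \<open>cf f 0 = \<zero>\<close> I.zero_closed by simp
  next
    case (Suc m)
    then show ?thesis
      using coeff_monom_mult[OF R.one_closed g(2), of 1 m] g by simp
  qed
  ultimately show "cf f 0 = \<zero> \<and> (\<forall>n. cf f n \<in> I)" by blast
next
  assume c: "cf f 0 = \<zero> \<and> (\<forall>n. cf f n \<in> I)"
  \<comment> \<open>\<open>g\<close> is \<open>f\<close> divided by \<open>X\<close>.\<close>
  define g where "g = (\<lambda>n. cf f (Suc n))"
  have "bound \<zero> (deg R f) g"
    using f deg_aboveD[OF _ f] by (intro bound.intro) (simp add: g_def)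
  then have g_up: "g \<in> up R" using f by (intro mem_upI) (auto simp: g_def)
  then have g: "g \<in> carrier P" unfolding P_def UP_def by simp
  \<comment> \<open>The coefficient function of \<open>UP R\<close> is restricted to
    \<open>up R\<close>, so it evaluates at \<open>g\<close> only after \<open>g_up\<close>.\<close>
  have cg: "cf g n = cf f (Suc n)" for n
  proof -
    have "cf g n = g n" using g_up unfolding P_def UP_def by simp
    then show ?thesis by (simp add: g_def)
  qed
  have "f = mon \<one> 1 \<otimes>\<^bsub>P\<^esub> g"
  proof (rule up_eqI)
    fix n
    show "cf f n = cf (mon \<one> 1 \<otimes>\<^bsub>P\<^esub> g) n"
    proof (cases n)
      case 0
      then show ?thesis using c g by simp
    next
      case (Suc m)
      then show ?thesis
        using coeff_monom_mult[OF R.one_closed g, of 1 m] g cg f by simp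
    qed
  qed (use f g in auto)
  moreover have "g \<in> coeff_ideal R I"
    using g cg c by (simp add: coeff_ideal_def P_def)
  ultimately show "f \<in> X_coeff_ideal R I"
    by (auto simp: X_coeff_ideal_def P_def)
qed

lemma ideal_X_coeff: "ideal (X_coeff_ideal R I) P"
  unfolding P_def by (rule ideal_X_coeff_ideal[OF R.is_cring I.is_ideal])

lemma cls_ring_hom: "cls \<in> ring_hom P S"
  using ideal.rcos_ring_hom[OF ideal_X_coeff]
  by (simp add: cls_def[abs_def] slash_ring_def P_def)

lemma cls_closed [simp]: "f \<in> carrier P \<Longrightarrow> cls f \<in> carrier S"
  and cls_mult: "f \<in> carrier P \<Longrightarrow> g \<in> carrier P \<Longrightarrow> cls f \<otimes>\<^bsub>S\<^esub> cls g = cls (f \<otimes>\<^bsub>P\<^esub> g)"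
  and cls_add: "f \<in> carrier P \<Longrightarrow> g \<in> carrier P \<Longrightarrow> cls f \<oplus>\<^bsub>S\<^esub> cls g = cls (f \<oplus>\<^bsub>P\<^esub> g)"
  and cls_one: "\<one>\<^bsub>S\<^esub> = cls \<one>\<^bsub>P\<^esub>"
  using ring_hom_closed[OF cls_ring_hom] ring_hom_mult[OF cls_ring_hom]
    ring_hom_add[OF cls_ring_hom] ring_hom_one[OF cls_ring_hom] by auto

lemma cls_zero: "\<zero>\<^bsub>S\<^esub> = cls \<zero>\<^bsub>P\<^esub>"
  and cls_minus: "f \<in> carrier P \<Longrightarrow> g \<in> carrier P \<Longrightarrow> cls f \<ominus>\<^bsub>S\<^esub> cls g = cls (f \<ominus>\<^bsub>P\<^esub> g)"
  and cls_pow: "f \<in> carrier P \<Longrightarrow> cls f [^]\<^bsub>S\<^esub> (n::nat) = cls (f [^]\<^bsub>P\<^esub> n)"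
proof -
  interpret cls: ring_hom_cring P S cls
    by (rule ring_hom_cringI[OF UP_cring S.is_cring cls_ring_hom])
  show "\<zero>\<^bsub>S\<^esub> = cls \<zero>\<^bsub>P\<^esub>"
    "f \<in> carrier P \<Longrightarrow> g \<in> carrier P \<Longrightarrow> cls f \<ominus>\<^bsub>S\<^esub> cls g = cls (f \<ominus>\<^bsub>P\<^esub> g)"
    "f \<in> carrier P \<Longrightarrow> cls f [^]\<^bsub>S\<^esub> n = cls (f [^]\<^bsub>P\<^esub> n)"
    by (simp_all add: a_minus_def)
qed

lemma carrier_S: "carrier S = cls ` carrier P"
  by (auto simp: slash_ring_def FactRing_def A_RCOSETS_def' cls_def P_def)

lemma emb_eq_cls: "emb c = cls (mon c 0)"
  by (simp add: slash_emb_def cls_def P_def)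

text \<open>Constant terms must agree exactly, the others only modulo \<open>I\<close>. Including
  \<open>n = 0\<close> in the second condition is harmless, the difference there being zero.\<close>

lemma cls_eq_iff:
  assumes "f \<in> carrier P" "g \<in> carrier P"
  shows "cls f = cls g \<longleftrightarrow>
    cf f 0 = cf g 0 \<and> (\<forall>n. cf f n \<ominus> cf g n \<in> I)"
proof -
  have "cls f = cls g \<longleftrightarrow> f \<ominus>\<^bsub>P\<^esub> g \<in> X_coeff_ideal R I"
    unfolding cls_def
    by (rule ring.quotient_eq_iff_same_a_r_cos[OF UP_ring ideal_X_coeff assms, symmetric])
  then show ?thesis
    using assms by (simp add: mem_X_coeff_ideal_iff)
qed

text \<open>The only constant that can represent the class of \<open>f\<close> is its constant term,
  and subtracting it leaves the coefficients of positive degree. Both SL and t-closedness are tested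
  through this criterion.\<close>

lemma cls_in_K_iff:
  assumes f: "f \<in> carrier P"
  shows "cls f \<in> K \<longleftrightarrow> (\<forall>n>0. cf f n \<in> I)"
proof
  assume "cls f \<in> K"
  then obtain c where c: "c \<in> carrier R" "cls f = cls (mon c 0)" by (auto simp: emb_eq_cls)
  have "cf f n \<in> I" if "n > 0" for n
  proof -
    have "cf f n \<ominus> cf (mon c 0) n \<in> I"
      using c f cls_eq_iff by simp
    then show ?thesis using that c f by (simp add: a_minus_def)
  qed
  then show "\<forall>n>0. cf f n \<in> I" by blast
next
  assume *: "\<forall>n>0. cf f n \<in> I"
  have "cf f n \<ominus> cf (mon (cf f 0) 0) n \<in> I" for n
    using * f I.zero_closed by (cases n) (simp_all add: a_minus_def R.r_neg)
  then have "cls f = emb (cf f 0)"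
    unfolding emb_eq_cls using f by (subst cls_eq_iff) auto
  then show "cls f \<in> K" using f by simp
qed

lemma cf_const_mult:
  assumes "c \<in> carrier R" "g \<in> carrier P"
  shows "cf (mon c 0 \<otimes>\<^bsub>P\<^esub> g) n = c \<otimes> cf g n"
  using coeff_monom_mult[OF assms, of 0 n] by simp

section \<open>Extending ideals of \<open>R\<close> to \<open>S\<close>\<close>

text \<open>This is the image of \<open>Q[X]\<close> in \<open>S\<close>. If
  \<open>I \<subseteq> Q\<close>, then the quotient of \<open>S\<close> by it is
  \<open>(R/Q)[X]\<close>.\<close>

definition ext :: "'a set \<Rightarrow> (nat \<Rightarrow> 'a) set set" where
  "ext Q = {cls f | f. f \<in> carrier P \<and> (\<forall>n. cf f n \<in> Q)}"

text \<open>Another representative changes each coefficient by an element of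
  \<open>I \<subseteq> Q\<close>, so any representative decides membership.\<close>

lemma cls_in_ext_iff:
  assumes Q: "ideal Q R" "I \<subseteq> Q" and f: "f \<in> carrier P"
  shows "cls f \<in> ext Q \<longleftrightarrow> (\<forall>n. cf f n \<in> Q)"
proof
  interpret Q: ideal Q R by fact
  assume "cls f \<in> ext Q"
  then obtain g where g: "g \<in> carrier P" "cls f = cls g" "\<And>n. cf g n \<in> Q"
    by (auto simp: ext_def)
  have "cf f n \<in> Q" for n
  proof -
    have "cf f n \<ominus> cf g n \<in> Q"
      using g f cls_eq_iff Q(2) by blast
    then have "(cf f n \<ominus> cf g n) \<oplus> cf g n \<in> Q" using g by (intro Q.a_closed)
    moreover have "(cf f n \<ominus> cf g n) \<oplus> cf g n = cf f n"
      using f g(1) by (simp add: a_minus_def R.a_assoc R.l_neg)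
    ultimately show ?thesis by simp
  qed
  then show "\<forall>n. cf f n \<in> Q" by blast
qed (use f in \<open>auto simp: ext_def\<close>)

lemma ideal_ext:
  assumes Q: "ideal Q R" and IQ: "I \<subseteq> Q"
  shows "ideal (ext Q) S"
proof -
  interpret Q: ideal Q R by fact
  note iff = cls_in_ext_iff[OF Q IQ]
  have sub: "ext Q \<subseteq> carrier S" by (auto simp: ext_def)
  have mult: "x \<otimes>\<^bsub>S\<^esub> a \<in> ext Q" if a: "a \<in> ext Q" and x: "x \<in> carrier S" for a x
  proof -
    obtain f where f: "f \<in> carrier P" "a = cls f" "\<And>n. cf f n \<in> Q"
      using a by (auto simp: ext_def)
    obtain g where g: "g \<in> carrier P" "x = cls g" using x by (auto simp: carrier_S)
    have sum: "finite A \<Longrightarrow> t \<in> A \<rightarrow> Q \<Longrightarrow> finsum R t A \<in> Q" for t and A :: "nat set"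
      by (induction rule: finite_induct) (auto simp: Pi_iff)
    have "cf (g \<otimes>\<^bsub>P\<^esub> f) n \<in> Q" for n
      using f g by (auto intro!: sum Q.I_l_closed)
    then show ?thesis using f g iff by (simp add: cls_mult)
  qed
  show ?thesis
  proof (rule idealI)
    show "subgroup (ext Q) (add_monoid S)"
    proof (rule S.add.subgroupI)
      show "ext Q \<subseteq> carrier S" by (rule sub)
      have "cls \<zero>\<^bsub>P\<^esub> \<in> ext Q" using iff Q.zero_closed by simp
      then show "ext Q \<noteq> {}" by blast
    next
      fix a assume a: "a \<in> ext Q"
      then have "(\<ominus>\<^bsub>S\<^esub> \<one>\<^bsub>S\<^esub>) \<otimes>\<^bsub>S\<^esub> a \<in> ext Q" by (intro mult) auto
      then show "\<ominus>\<^bsub>S\<^esub> a \<in> ext Q" using a sub by (auto simp: S.l_minus subset_iff)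
    next
      fix a b assume "a \<in> ext Q" "b \<in> ext Q"
      then obtain f g where
        f: "f \<in> carrier P" "a = cls f" "\<And>n. cf f n \<in> Q" and
        g: "g \<in> carrier P" "b = cls g" "\<And>n. cf g n \<in> Q"
        by (auto simp: ext_def)
      then show "a \<oplus>\<^bsub>S\<^esub> b \<in> ext Q" using iff by (simp add: cls_add Q.a_closed)
    qed
  next
    fix a x assume "a \<in> ext Q" "x \<in> carrier S"
    then show "x \<otimes>\<^bsub>S\<^esub> a \<in> ext Q" "a \<otimes>\<^bsub>S\<^esub> x \<in> ext Q"
      using mult[of a x] sub by (auto simp: S.m_comm subset_iff)
  qed (rule S.ring_axioms)
qed

text \<open>The quotient \<open>(R/Q)[X]\<close> is a domain: if both factors had a coefficient
  outside \<open>Q\<close>, so would the product. The constant term of \<open>\<one>\<close> shows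
  properness.\<close>

lemma primeideal_ext:
  assumes Q: "primeideal Q R" and IQ: "I \<subseteq> Q"
  shows "primeideal (ext Q) S"
proof (rule primeidealI)
  interpret Q: primeideal Q R by fact
  note iff = cls_in_ext_iff[OF Q.is_ideal IQ]
  show "ideal (ext Q) S" by (rule ideal_ext[OF Q.is_ideal IQ])
  show "cring S" by (rule S.is_cring)
  have "\<one> \<notin> Q" using Q.one_imp_carrier Q.I_notcarr by auto
  then have "\<one>\<^bsub>S\<^esub> \<notin> ext Q"
    unfolding cls_one by (subst iff) (auto intro!: exI[of _ 0])
  then show "carrier S \<noteq> ext Q" using S.one_closed by blast
  fix a b assume "a \<in> carrier S" "b \<in> carrier S" and ab: "a \<otimes>\<^bsub>S\<^esub> b \<in> ext Q"
  then obtain f g where fg: "f \<in> carrier P" "a = cls f" "g \<in> carrier P" "b = cls g"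
    by (auto simp: carrier_S)
  have "\<forall>n. cf (f \<otimes>\<^bsub>P\<^esub> g) n \<in> Q"
    using ab fg iff[OF P.m_closed[OF fg(1,3)]] cls_mult by metis
  then show "a \<in> ext Q \<or> b \<in> ext Q"
    using prime_coeffs_mult[OF Q fg(1,3)] iff fg by metis
qed

text \<open>A polynomial in \<open>I[X]\<close> differs from its constant term by an element of
  \<open>X I[X]\<close>. Hence the copy of \<open>I\<close> inside \<open>R\<close> is already an
  ideal of \<open>S\<close>.\<close>

lemma emb_image_eq_ext: "emb ` I = ext I"
proof (intro equalityI subsetI)
  fix x assume "x \<in> emb ` I"
  then obtain c where c: "c \<in> I" "x = cls (mon c 0)" by (auto simp: emb_eq_cls)
  then show "x \<in> ext I" by (auto simp: ext_def intro!: exI[of _ "mon c 0"])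
next
  fix x assume "x \<in> ext I"
  then obtain f where f: "f \<in> carrier P" "x = cls f" "\<And>n. cf f n \<in> I"
    by (auto simp: ext_def)
  then have "cf f n \<ominus> cf (mon (cf f 0) 0) n \<in> I" for n
    by (cases n) (simp_all add: a_minus_def R.r_neg)
  then have "x = emb (cf f 0)"
    unfolding emb_eq_cls f(2) using f(1) by (subst cls_eq_iff) auto
  then show "x \<in> emb ` I" using f(3) by blast
qed

section \<open>The conductor\<close>

lemma conductor_eq: "conductor K S = emb ` I"
proof (intro equalityI subsetI)
  fix x assume x: "x \<in> conductor K S"
  then obtain c where c: "c \<in> carrier R" "x = emb c" by (auto simp: conductor_def)
  \<comment> \<open>The class of \<open>X\<close> is the test element: multiplication by it moves
    \<open>c\<close> to index 1, where lying in \<open>K\<close> forces \<open>c\<close> into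
    \<open>I\<close>.\<close>
  have "x \<otimes>\<^bsub>S\<^esub> cls (mon \<one> 1) \<in> K" using x by (simp add: conductor_def)
  then have "cls (mon c 0 \<otimes>\<^bsub>P\<^esub> mon \<one> 1) \<in> K" using c by (simp add: emb_eq_cls cls_mult)
  then have "cf (mon c 0 \<otimes>\<^bsub>P\<^esub> mon \<one> 1) 1 \<in> I"
    using c cls_in_K_iff[of "mon c 0 \<otimes>\<^bsub>P\<^esub> mon \<one> 1"] by (simp del: coeff_mult)
  moreover have "cf (mon c 0 \<otimes>\<^bsub>P\<^esub> mon \<one> 1) 1 = c"
    using c cf_const_mult[of c "mon \<one> 1" 1] by (simp del: coeff_mult)
  ultimately have "c \<in> I" by simp
  then show "x \<in> emb ` I" using c by blast
next
  fix x assume "x \<in> emb ` I"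
  then obtain c where c: "c \<in> I" "x = emb c" by blast
  then have c': "c \<in> carrier R" by simp
  \<comment> \<open>Every coefficient of \<open>c g\<close> is a multiple of \<open>c\<close>, hence
    in \<open>I\<close>, in particular those of positive degree.\<close>
  have "x \<otimes>\<^bsub>S\<^esub> s \<in> K" if s: "s \<in> carrier S" for s
  proof -
    obtain g where g: "g \<in> carrier P" "s = cls g" using s by (auto simp: carrier_S)
    have "x \<otimes>\<^bsub>S\<^esub> s = cls (mon c 0 \<otimes>\<^bsub>P\<^esub> g)"
      using c c' g by (simp add: emb_eq_cls cls_mult)
    moreover have "cf (mon c 0 \<otimes>\<^bsub>P\<^esub> g) n \<in> I" for n
      unfolding cf_const_mult[OF c' g(1)] using c g by (intro I.I_r_closed) auto
    ultimately show ?thesis using c' g by (simp only: cls_in_K_iff P.m_closed monom_closed) blast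
  qed
  then show "x \<in> conductor K S" using c c' by (auto simp: conductor_def)
qed

section \<open>Evaluation at zero and purity\<close>

text \<open>Evaluation at \<open>X = 0\<close> through an arbitrary representative; the value is put
  back into \<open>S\<close> by \<open>emb\<close>, so that it lies in \<open>K\<close>.\<close>

definition retraction :: "(nat \<Rightarrow> 'a) set \<Rightarrow> (nat \<Rightarrow> 'a) set" where
  "retraction s = emb (cf (SOME f. f \<in> carrier P \<and> cls f = s) 0)"

text \<open>Polynomials with the same class have the same constant term, so the choice of
  representative does not matter.\<close>

lemma retraction_cls:
  assumes "f \<in> carrier P"
  shows "retraction (cls f) = emb (cf f 0)"
proof -
  let ?g = "SOME g. g \<in> carrier P \<and> cls g = cls f"
  have "?g \<in> carrier P \<and> cls ?g = cls f" by (rule someI[of _ f]) (simp add: assms)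
  then have "cf ?g 0 = cf f 0" using assms cls_eq_iff by blast
  then show ?thesis by (simp add: retraction_def)
qed

lemma retraction_hom: "retraction \<in> ring_hom S (S\<lparr>carrier := K\<rparr>)"
proof -
  note emb_hom = slash_emb_ring_hom[OF R.is_cring I.is_ideal]
  show ?thesis
  proof (rule ring_hom_memI)
    fix x assume "x \<in> carrier S"
    then show "retraction x \<in> carrier (S\<lparr>carrier := K\<rparr>)"
      by (auto simp: carrier_S retraction_cls)
  next
    fix x y assume "x \<in> carrier S" "y \<in> carrier S"
    then obtain f g where fg: "f \<in> carrier P" "x = cls f" "g \<in> carrier P" "y = cls g"
      by (auto simp: carrier_S)
    show "retraction (x \<otimes>\<^bsub>S\<^esub> y) = retraction x \<otimes>\<^bsub>S\<lparr>carrier := K\<rparr>\<^esub> retraction y"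
      using fg ring_hom_mult[OF emb_hom, of "cf f 0" "cf g 0"]
      by (simp add: cls_mult retraction_cls)
    show "retraction (x \<oplus>\<^bsub>S\<^esub> y) = retraction x \<oplus>\<^bsub>S\<lparr>carrier := K\<rparr>\<^esub> retraction y"
      using fg ring_hom_add[OF emb_hom, of "cf f 0" "cf g 0"]
      by (simp add: cls_add retraction_cls)
  next
    show "retraction \<one>\<^bsub>S\<^esub> = \<one>\<^bsub>S\<lparr>carrier := K\<rparr>\<^esub>"
      using ring_hom_one[OF emb_hom] by (simp add: cls_one retraction_cls)
  qed
qed

lemma pure_slash: "pure_extension TYPE('c) K S"
proof (rule retract_imp_pure_extension[OF S.is_cring _ retraction_hom])
  show "subcring K S" by (rule subcring_slash_emb[OF R.is_cring I.is_ideal])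
  fix x assume "x \<in> K"
  then show "retraction x = x" by (auto simp: emb_eq_cls retraction_cls)
qed

end

section \<open>Semiprime \<open>I\<close>\<close>

text \<open>Fixing the family of primes lets membership in \<open>I\<close> be tested one prime at a
  time.\<close>

locale slash_semiprime = slash_extension +
  fixes \<Q>
  assumes primes: "\<And>Q. Q \<in> \<Q> \<Longrightarrow> primeideal Q R"
    and I_eq: "I = carrier R \<inter> \<Inter>\<Q>"
begin

lemma I_subset: "Q \<in> \<Q> \<Longrightarrow> I \<subseteq> Q"
  using I_eq by blast

lemma mem_I: "c \<in> carrier R \<Longrightarrow> (\<And>Q. Q \<in> \<Q> \<Longrightarrow> c \<in> Q) \<Longrightarrow> c \<in> I"
  using I_eq by blast

lemma one_notin: "Q \<in> \<Q> \<Longrightarrow> \<one> \<notin> Q"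
  using primes ideal.one_imp_carrier primeideal.I_notcarr primeideal.axioms(1) by metis

section \<open>Units and t-closedness\<close>

text \<open>If \<open>f g\<close> is congruent to 1, then both constant terms are units. A
  coefficient of \<open>f\<close> of positive degree outside some \<open>Q\<close> would make
  \<open>f g\<close> nonconstant modulo \<open>Q\<close>.\<close>

lemma left_factor_of_one_in_K:
  assumes xy: "x \<in> carrier S" "y \<in> carrier S" and one: "x \<otimes>\<^bsub>S\<^esub> y = \<one>\<^bsub>S\<^esub>"
  shows "x \<in> K"
proof -
  obtain f g where fg: "f \<in> carrier P" "x = cls f" "g \<in> carrier P" "y = cls g"
    using xy by (auto simp: carrier_S)
  have c: "cls (f \<otimes>\<^bsub>P\<^esub> g) = cls \<one>\<^bsub>P\<^esub>" using one fg by (simp add: cls_mult cls_one)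
  have fg_closed: "f \<otimes>\<^bsub>P\<^esub> g \<in> carrier P" using fg by simp
  have "cf (f \<otimes>\<^bsub>P\<^esub> g) 0 = \<one>"
    using c cls_eq_iff[OF fg_closed P.one_closed] by simp
  then have c0: "cf f 0 \<otimes> cf g 0 = \<one>" using fg by simp
  have "cls (f \<otimes>\<^bsub>P\<^esub> g) \<in> K"
    unfolding c by (subst cls_in_K_iff) (auto simp: I.zero_closed)
  then have cn: "cf (f \<otimes>\<^bsub>P\<^esub> g) n \<in> I" if "n > 0" for n
    using cls_in_K_iff[OF fg_closed] that by blast
  have "cf f n \<in> Q" if Q: "Q \<in> \<Q>" and n: "n > 0" for Q n
  proof (rule ccontr)
    assume fn: "cf f n \<notin> Q"
    \<comment> \<open>Otherwise \<open>Q\<close> would contain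
      \<open>cf f 0 \<otimes> cf g 0 = \<one>\<close>. So \<open>g\<close> has degree at least 0
      modulo \<open>Q\<close>, and the index found below is at least \<open>n\<close>.\<close>
    have "cf g 0 \<notin> Q"
      using c0 one_notin[OF Q] ideal.I_l_closed[OF primeideal.axioms(1)[OF primes[OF Q]]] fg
      by (metis coeff_closed)
    then obtain k where "n + 0 \<le> k" "cf (f \<otimes>\<^bsub>P\<^esub> g) k \<notin> Q"
      using prime_coeffs_mult[OF primes[OF Q] fg(1,3) fn] by blast
    then show False using cn[of k] n I_subset[OF Q] by auto
  qed
  then show ?thesis
    using fg by (auto simp: cls_in_K_iff intro!: mem_I)
qed

lemma strongly_local_slash: "strongly_local K S"
  unfolding strongly_local_def
proof (intro equalityI subsetI)
  fix x assume "x \<in> Units (S\<lparr>carrier := K\<rparr>)"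
  moreover have "K \<subseteq> carrier S" by (auto simp: emb_eq_cls)
  ultimately show "x \<in> Units S" by (auto simp: Units_def)
next
  fix x assume "x \<in> Units S"
  then obtain y where "x \<in> carrier S" "y \<in> carrier S" "x \<otimes>\<^bsub>S\<^esub> y = \<one>\<^bsub>S\<^esub>" "y \<otimes>\<^bsub>S\<^esub> x = \<one>\<^bsub>S\<^esub>"
    by (auto simp: Units_def)
  \<comment> \<open>The inverse must lie in \<open>K\<close> as well, hence the lemma is applied
    with the factors in both orders.\<close>
  then show "x \<in> Units (S\<lparr>carrier := K\<rparr>)"
    using left_factor_of_one_in_K[of x y] left_factor_of_one_in_K[of y x]
    by (auto simp: Units_def)
qed

text \<open>The quadratic condition factors as \<open>b (b - r)\<close>, with \<open>r\<close> the
  class of a constant. Thus \<open>f\<close> and \<open>f - c\<close> have the same coefficients of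
  positive degree, and neither can leave \<open>Q\<close> without their product being nonconstant
  modulo \<open>Q\<close>.\<close>

lemma t_closed_slash: "t_closed K S"
  unfolding t_closed_def
proof (intro ballI impI, elim bexE conjE)
  fix b r assume b: "b \<in> carrier S" and r: "r \<in> K"
    and sq: "b [^]\<^bsub>S\<^esub> (2::nat) \<ominus>\<^bsub>S\<^esub> r \<otimes>\<^bsub>S\<^esub> b \<in> K"
  obtain f where f: "f \<in> carrier P" "b = cls f" using b by (auto simp: carrier_S)
  obtain c where c: "c \<in> carrier R" "r = cls (mon c 0)" using r by (auto simp: emb_eq_cls)
  let ?g = "f \<ominus>\<^bsub>P\<^esub> mon c 0"
  have g: "?g \<in> carrier P" using f c by simp
  have r': "r \<in> carrier S" using c by simp
  have cg: "cls ?g = b \<ominus>\<^bsub>S\<^esub> r"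
    using f c by (simp add: cls_minus)
  have "cls (f \<otimes>\<^bsub>P\<^esub> ?g) = b \<otimes>\<^bsub>S\<^esub> (b \<ominus>\<^bsub>S\<^esub> r)"
    using cls_mult[OF f(1) g] cg f by simp
  also have "\<dots> = b [^]\<^bsub>S\<^esub> (2::nat) \<ominus>\<^bsub>S\<^esub> r \<otimes>\<^bsub>S\<^esub> b"
    using b r' by (simp add: a_minus_def S.r_distr S.r_minus S.m_comm numeral_2_eq_2)
  finally have "cls (f \<otimes>\<^bsub>P\<^esub> ?g) \<in> K" using sq by simp
  then have cn: "cf (f \<otimes>\<^bsub>P\<^esub> ?g) n \<in> I" if "n > 0" for n
    using cls_in_K_iff[OF P.m_closed[OF f(1) g]] that by blast
  have "cf f n \<in> Q" if Q: "Q \<in> \<Q>" and n: "n > 0" for Q n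
  proof (rule ccontr)
    assume fn: "cf f n \<notin> Q"
    \<comment> \<open>The subtracted constant only affects index 0, so both factors have degree at
      least \<open>n\<close> modulo \<open>Q\<close>, and \<open>n + n > 0\<close>.\<close>
    have "cf ?g n = cf f n" using f c n by (simp add: a_minus_def)
    then obtain k where "n + n \<le> k" "cf (f \<otimes>\<^bsub>P\<^esub> ?g) k \<notin> Q"
      using prime_coeffs_mult[OF primes[OF Q] f(1) g fn, of n] fn by auto
    then show False using cn[of k] n I_subset[OF Q] by auto
  qed
  then show "b \<in> K"
    using f by (auto simp: cls_in_K_iff intro!: mem_I)
qed

section \<open>Semiprimality of \<open>I\<close> in \<open>S\<close>, and reducedness\<close>

text \<open>The ideals \<open>ext Q\<close> form the witnessing family. Membership in them and in
  \<open>ext I\<close> is decided by coefficients, so their intersection is computed coefficient by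
  coefficient.\<close>

lemma semiprime_slash: "semiprime_ideal (emb ` I) S"
  unfolding semiprime_ideal_def
proof (intro exI conjI ballI)
  show "primeideal P' S" if "P' \<in> ext ` \<Q>" for P'
    using that primeideal_ext primes I_subset by auto
  have "cls f \<in> ext I \<longleftrightarrow> (\<forall>Q\<in>\<Q>. cls f \<in> ext Q)" if f: "f \<in> carrier P" for f
  proof -
    have "cls f \<in> ext Q \<longleftrightarrow> (\<forall>n. cf f n \<in> Q)" if "Q \<in> \<Q>" for Q
      using that by (intro cls_in_ext_iff primeideal.axioms(1) primes I_subset f)
    moreover have "cls f \<in> ext I \<longleftrightarrow> (\<forall>n. cf f n \<in> I)"
      by (intro cls_in_ext_iff I.is_ideal subset_refl f)
    moreover have "cf f n \<in> I \<longleftrightarrow> (\<forall>Q\<in>\<Q>. cf f n \<in> Q)" for n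
      using coeff_closed[OF f, of n] I_eq by blast
    ultimately show ?thesis by blast
  qed
  moreover have "ext I \<subseteq> carrier S" by (auto simp: ext_def)
  ultimately show "emb ` I = carrier S \<inter> \<Inter>(ext ` \<Q>)"
    unfolding emb_image_eq_ext carrier_S by auto
qed

text \<open>A nilpotent class is killed in two ways: its constant term is nilpotent in
  \<open>R\<close>, hence zero, and modulo each \<open>Q\<close> the polynomial is nilpotent in a
  domain, so all its coefficients lie in \<open>I\<close>.\<close>

lemma reduced_slash:
  assumes R: "reduced_ring R" and nontriv: "\<one> \<noteq> \<zero>"
  shows "reduced_ring S"
  unfolding reduced_ring_def
proof (intro ballI allI impI)
  fix a and n :: nat
  assume "a \<in> carrier S" and nil: "a [^]\<^bsub>S\<^esub> n = \<zero>\<^bsub>S\<^esub>"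
  then obtain f where f: "f \<in> carrier P" "a = cls f" by (auto simp: carrier_S)
  let ?p = "f [^]\<^bsub>P\<^esub> n"
  have p: "?p \<in> carrier P" using f by simp
  have "cls ?p = cls \<zero>\<^bsub>P\<^esub>" using nil f by (simp add: cls_pow cls_zero)
  then have p0: "cf ?p 0 = \<zero>" and pI: "cf ?p k \<ominus> \<zero> \<in> I" for k
    using cls_eq_iff[OF p P.zero_closed] by auto
  have pI: "cf ?p k \<in> I" for k using pI[of k] p by (simp add: a_minus_def)
  \<comment> \<open>Taking constant terms commutes with powers, which transfers nilpotency to
    \<open>R\<close>.\<close>
  have "cf (f [^]\<^bsub>P\<^esub> m) 0 = cf f 0 [^] m" for m :: nat
    using f by (induction m) auto
  then have f0: "cf f 0 = \<zero>"
    using R p0 f unfolding reduced_ring_def by (metis coeff_closed)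
  have "cf f k \<in> Q" if Q: "Q \<in> \<Q>" for Q k
    using prime_coeffs_pow[OF primes[OF Q] f(1), of k n] pI I_subset[OF Q] by blast
  then have "cf f k \<in> I" for k using f by (auto intro: mem_I)
  then have "cls f = cls \<zero>\<^bsub>P\<^esub>"
    using f f0 by (subst cls_eq_iff) (auto simp: a_minus_def)
  then show "a = \<zero>\<^bsub>S\<^esub>" using f by (simp add: cls_zero)
qed

end

theorem proposition6p7:
  fixes R :: "('a, 'm) ring_scheme" and I :: "'a set"
  assumes "cring R" and "\<one>\<^bsub>R\<^esub> \<noteq> \<zero>\<^bsub>R\<^esub>"
    and "semiprime_ideal I R"
  defines "S \<equiv> slash_ring R I"
    and "K \<equiv> slash_emb R I ` carrier R"
    and "J \<equiv> slash_emb R I ` I"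
  shows "strongly_local K S \<and> pure_extension TYPE('c) K S \<and> t_closed K S \<and>
         J = conductor K S \<and> semiprime_ideal J S \<and>
         (reduced_ring R \<longrightarrow> reduced_ring S)"
proof -
  obtain \<Q> where \<Q>: "\<And>Q. Q \<in> \<Q> \<Longrightarrow> primeideal Q R" "I = carrier R \<inter> \<Inter>\<Q>"
    using assms(3) unfolding semiprime_ideal_def by blast
  have "slash_extension R I"
    using slash_extension.intro[OF UP_cring.intro[OF assms(1)]]
      semiprime_ideal_imp_ideal[OF assms(1,3)] by blast
  moreover have "slash_semiprime_axioms R I \<Q>"
    by (rule slash_semiprime_axioms.intro[OF \<Q>])
  ultimately have "slash_semiprime R I \<Q>"
    by (rule slash_semiprime.intro)
  then interpret slash_semiprime R "UP R" I \<Q> .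
  show ?thesis
    unfolding S_def K_def J_def
    by (intro conjI impI strongly_local_slash pure_slash t_closed_slash conductor_eq[symmetric]
          semiprime_slash reduced_slash[OF _ assms(2)])
qed

end
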